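(* Let $T_0$ be a $b\times a$ vertical brick ($a<b$) that is excessive and not connected, and let $W_1,\dots,W_p$ ($p\ge 2$) be its connected components. (Each $W_i$ is vertical, i.e. has more rows than columns, and excessive.) Let $m_i>0$ be the excess of $W_i$, let $\mathrm{imb}(W_i)=|\mathrm{row}(W_i)|-|\mathrm{col}(W_i)|>0$ be its imbalance, let $S_i=B\times\mathrm{col}(W_i)$ be its vertical strip, and put $s_i=\min\{m_i,\mathrm{imb}(W_i)\}$. Then: (a) each strip $S_i$ contains a hole of vcount $b-s_i$; (b) $T_0$ is $m$-excessive with $m=\min\{s_1,\dots,s_p\}$; (c) $\mathrm{imb}(W_1)+\cdots+\mathrm{imb}(W_p)=\mathrm{imb}(T_0)=b-a$.
   Context: $T_0=B\times A$ is the grid (rows $B$, columns $A$, $|B|=b$, $|A|=a$) of a finite simple bipartite graph without isolated vertices; a dot in cell $(y,x)$ means that $x\in A$ and $y\in B$ are adjacent. A brick $T=Y\times X$ (nonempty $Y\subseteq B$, $X\subseteq A$) is identified with the subgraph induced on $X\cup Y$; $\mathrm{row}(T)=Y$, $\mathrm{col}(T)=X$, $\mathrm{vcount}(T)=|X|+|Y|$. A hole of $T$ is a dot-free sub-brick $Y'\times X'$ with $\emptyset\neq Y'\subsetneq Y$, $\emptyset\ne X'\subsetneq X$; $\alpha_p(T)$ is the maximum vcount of a hole of $T$ ($0$ if none). For a brick $T$ with $|\mathrm{col}(T)|\le|\mathrm{row}(T)|$ the characteristic is $|\mathrm{row}(T)|-\alpha_p(T)$; $T$ is $m$-excessive, with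 excess $m$, if the characteristic equals $m>0$. In (a), "a hole in $S_i$" means a hole of $T_0$ (a dot-free $Y'\times X'$ with $\emptyset\ne Y'\subsetneq B$, $\emptyset\ne X'\subsetneq A$) contained in $S_i$. *)

theory Defs
  imports "Graph_Theory.Graph_Theory"
begin

text \<open>Simple graphs are the finite, loop-free symmetric digraphs without parallel arcs of the
  locale \<^locale>\<open>graph\<close>. The grid has row set \<open>B\<close> and column set \<open>A\<close>.\<close>

locale bipartite_grid = graph G
  for G :: "('v, 'e) pre_digraph" and B :: "'v set" and A :: "'v set" +
  assumes verts_eq: "verts G = B \<union> A"
    and sides_disjoint: "B \<inter> A = {}"
    and bipartite: "u \<rightarrow>\<^bsub>G\<^esub> v \<Longrightarrow> (u \<in> B \<and> v \<in> A) \<or> (u \<in> A \<and> v \<in> B)"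
    and no_isolated: "v \<in> verts G \<Longrightarrow> \<exists>w. v \<rightarrow>\<^bsub>G\<^esub> w"

text \<open>A pair \<open>(Y, X)\<close> stands for the brick with rows \<open>Y\<close> and columns \<open>X\<close>.\<close>

type_synonym 'v brick = "'v set \<times> 'v set"

abbreviation row :: "'v brick \<Rightarrow> 'v set" where
  "row T \<equiv> fst T"

abbreviation col :: "'v brick \<Rightarrow> 'v set" where
  "col T \<equiv> snd T"

definition vcount :: "'v brick \<Rightarrow> nat" where
  "vcount T = card (col T) + card (row T)"

definition imb :: "'v brick \<Rightarrow> int" where
  "imb T = int (card (row T)) - int (card (col T))"

definition vertical :: "'v brick \<Rightarrow> bool" where
  "vertical T \<longleftrightarrow> card (col T) < card (row T)"

definition sub_brick :: "'v brick \<Rightarrow> 'v brick \<Rightarrow> bool" where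
  "sub_brick T' T \<longleftrightarrow>
     row T' \<noteq> {} \<and> col T' \<noteq> {} \<and> row T' \<subseteq> row T \<and> col T' \<subseteq> col T"

definition dot_free :: "('v, 'e) pre_digraph \<Rightarrow> 'v brick \<Rightarrow> bool" where
  "dot_free G T \<longleftrightarrow> (\<forall>y\<in>row T. \<forall>x\<in>col T. \<not> y \<rightarrow>\<^bsub>G\<^esub> x)"

definition hole :: "('v, 'e) pre_digraph \<Rightarrow> 'v brick \<Rightarrow> 'v brick \<Rightarrow> bool" where
  "hole G T H \<longleftrightarrow>
     sub_brick H T \<and> row H \<noteq> row T \<and> col H \<noteq> col T \<and> dot_free G H"

definition alpha_p :: "('v, 'e) pre_digraph \<Rightarrow> 'v brick \<Rightarrow> nat" where
  "alpha_p G T = (if \<exists>H. hole G T H then Max (vcount ` {H. hole G T H}) else 0)"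

text \<open>Only meaningful for bricks with at least as many rows as columns.\<close>

definition characteristic :: "('v, 'e) pre_digraph \<Rightarrow> 'v brick \<Rightarrow> int" where
  "characteristic G T = int (card (row T)) - int (alpha_p G T)"

definition m_excessive :: "('v, 'e) pre_digraph \<Rightarrow> int \<Rightarrow> 'v brick \<Rightarrow> bool" where
  "m_excessive G m T \<longleftrightarrow>
     card (col T) \<le> card (row T) \<and> characteristic G T = m \<and> 0 < m"

definition excessive :: "('v, 'e) pre_digraph \<Rightarrow> 'v brick \<Rightarrow> bool" where
  "excessive G T \<longleftrightarrow> (\<exists>m. m_excessive G m T)"

definition brick_graph :: "('v, 'e) pre_digraph \<Rightarrow> 'v brick \<Rightarrow> ('v, 'e) pre_digraph" where
  "brick_graph G T = G \<restriction> (row T \<union> col T)"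

text \<open>The connected components of the brick \<open>T\<close>, as sub-bricks. Requiring both sides of a
  component to be nonempty (part of \<^const>\<open>sub_brick\<close>) loses nothing in the absence of
  isolated vertices. Maximality is among all induced subgraphs, not only among bricks.\<close>

definition components :: "('v, 'e) pre_digraph \<Rightarrow> 'v brick \<Rightarrow> 'v brick set" where
  "components G T = {W. sub_brick W T \<and> connected (brick_graph G W) \<and>
     (\<forall>V. row W \<union> col W \<subset> V \<and> V \<subseteq> row T \<union> col T \<longrightarrow> \<not> connected (G \<restriction> V))}"

end

(* Adding all rows outside a component W to a hole of W gives a hole of the grid; the columns of W
   with all rows outside W form another. This gives the holes of (a), and comparing their
   sizes with |B| shows that W is vertical and excessive. Conversely, a hole of the grid meets each component W in
   at most |row W| vertices, and in at most |row W| - min (excess, imbalance) vertices if it contains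
   a column of W. Summing over the components bounds the hole by |B| - s_i for some i. *)

theory Submission
  imports Defs
begin

section \<open>Holes and the maximum behind \<open>alpha_p\<close>\<close>

lemma finite_holes:
  assumes "finite (row T)" "finite (col T)"
  shows "finite {H. hole G T H}"
proof (rule finite_subset)
  show "{H. hole G T H} \<subseteq> Pow (row T) \<times> Pow (col T)"
    by (auto simp: hole_def sub_brick_def)
qed (use assms in auto)

lemma hole_le_alpha_p:
  assumes "finite (row T)" "finite (col T)" "hole G T H"
  shows "vcount H \<le> alpha_p G T"
proof -
  have "vcount H \<le> Max (vcount ` {H. hole G T H})"
    using assms(3) finite_holes[OF assms(1,2)] by (intro Max_ge finite_imageI) auto
  moreover have "\<exists>H. hole G T H" using assms(3) by blast
  ultimately show ?thesis by (simp only: alpha_p_def if_True)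
qed

text \<open>A nonzero value rules out the default 0 of \<open>alpha_p\<close>, so it is a maximum
  over a finite nonempty set.\<close>

lemma alpha_p_attained:
  assumes "finite (row T)" "finite (col T)" "alpha_p G T \<noteq> 0"
  obtains H where "hole G T H" "vcount H = alpha_p G T"
proof -
  have ne: "{H. hole G T H} \<noteq> {}"
    using assms(3) by (auto simp: alpha_p_def split: if_splits)
  then have "Max (vcount ` {H. hole G T H}) \<in> vcount ` {H. hole G T H}"
    using finite_holes[OF assms(1,2)] by (intro Max_in) auto
  then show thesis using that ne by (auto simp: alpha_p_def)
qed

section \<open>Connected components as strongly connected components\<close>

text \<open>\<open>connected\<close> means strong connectivity of the symmetric closure. Restricting
  to \<open>V\<close> keeps the arcs symmetric, so the closure adds no reachability.\<close>

lemma (in sym_digraph) connected_induce_iff: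
  assumes "V \<subseteq> verts G"
  shows "connected (G \<restriction> V) \<longleftrightarrow> strongly_connected (G \<restriction> V)"
proof -
  interpret V: wf_digraph "G \<restriction> V" by (rule wellformed_induce_subgraph)
  have "symmetric (G \<restriction> V)"
    using sym_arcs by (fastforce simp: symmetric_conv)
  then show ?thesis
    by (simp add: connected_def strongly_connected_def V.reachable_mk_symmetric_eq)
qed

text \<open>Links the maximality condition in \<open>components\<close> to
  \<open>sccs_verts\<close>, so that disjointness and covering can be taken from the theory of
  strongly connected components. Maximality among induced subgraphs becomes maximality among vertex
  sets because an induced subgraph is determined by its vertices.\<close>

lemma (in sym_digraph) sccs_verts_iff_maximal_connected:
  "S \<in> sccs_verts \<longleftrightarrow> S \<subseteq> verts G \<and> connected (G \<restriction> S) \<and>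
    (\<forall>V. S \<subset> V \<and> V \<subseteq> verts G \<longrightarrow> \<not> connected (G \<restriction> V))"
proof -
  have ex_iff: "(\<exists>H. induced_subgraph H G \<and> strongly_connected H \<and> S \<subset> verts H) \<longleftrightarrow>
      (\<exists>V\<subseteq>verts G. strongly_connected (G \<restriction> V) \<and> S \<subset> V)" (is "?L \<longleftrightarrow> ?R")
  proof
    assume ?L
    then obtain H where H: "induced_subgraph H G" "strongly_connected H" "S \<subset> verts H" by blast
    then have "verts H \<subseteq> verts G" "G \<restriction> verts H = H"
      using induce_eq_iff_induced by (auto simp: induced_subgraph_def subgraph_def)
    then show ?R using H(2,3) by (intro exI[of _ "verts H"]) simp
  next
    assume ?R
    then obtain V where "V \<subseteq> verts G" "strongly_connected (G \<restriction> V)" "S \<subset> V" by blast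
    then show ?L by (intro exI[of _ "G \<restriction> V"]) (simp add: induced_induce)
  qed
  have "S \<in> sccs_verts \<longleftrightarrow> induced_subgraph (G \<restriction> S) G \<and> strongly_connected (G \<restriction> S) \<and>
      \<not> (\<exists>H. induced_subgraph H G \<and> strongly_connected H \<and> S \<subset> verts H)"
    by (simp add: in_sccs_verts_conv sccs_def)
  also have "induced_subgraph (G \<restriction> S) G \<longleftrightarrow> S \<subseteq> verts G"
    using induced_induce by (auto simp: induced_subgraph_def subgraph_def)
  finally show ?thesis
    unfolding ex_iff by (auto simp: connected_induce_iff)
qed

context bipartite_grid
begin

section \<open>The components partition the rows and the columns of the grid\<close>

lemma finite_rows: "finite B" and finite_cols: "finite A"
  using finite_verts verts_eq by auto

text \<open>Since \<open>B \<union> A\<close> is the whole vertex set, maximality inside the brick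
  is maximality inside \<open>G\<close>.\<close>

lemma components_iff:
  "W \<in> components G (B, A) \<longleftrightarrow> sub_brick W (B, A) \<and> row W \<union> col W \<in> sccs_verts"
  unfolding components_def sccs_verts_iff_maximal_connected brick_graph_def
  by (auto simp: verts_eq sub_brick_def)

lemma component_sub_brick:
  assumes "W \<in> components G (B, A)"
  shows "row W \<noteq> {}" "col W \<noteq> {}" "row W \<subseteq> B" "col W \<subseteq> A"
  using assms by (auto simp: components_iff sub_brick_def)

text \<open>Arcs are symmetric, so the ends of an arc reach each other.\<close>

lemma adj_sccs_verts:
  assumes "S \<in> sccs_verts" "u \<rightarrow>\<^bsub>G\<^esub> v"
  shows "u \<in> S \<longleftrightarrow> v \<in> S"
proof -
  have "u \<rightarrow>\<^sup>*\<^bsub>G\<^esub> v" "v \<rightarrow>\<^sup>*\<^bsub>G\<^esub> u"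
    using assms(2) symmetric_reachable' by blast+
  then show ?thesis using assms(1) by (auto simp: in_sccs_verts_conv_reachable)
qed

lemma adj_component:
  assumes "W \<in> components G (B, A)" "y \<rightarrow>\<^bsub>G\<^esub> x" "y \<in> B"
  shows "y \<in> row W \<longleftrightarrow> x \<in> col W"
  using adj_sccs_verts[of "row W \<union> col W" y x] assms component_sub_brick[OF assms(1)]
    bipartite[OF assms(2)] sides_disjoint by (auto simp: components_iff)

text \<open>A vertex of \<open>S\<close> has a neighbour, as no vertex is isolated. The neighbour
  lies in \<open>S\<close> and on the opposite side of the grid, so \<open>S\<close> meets both
  sides.\<close>

lemma sccs_verts_component:
  assumes "S \<in> sccs_verts"
  shows "(S \<inter> B, S \<inter> A) \<in> components G (B, A)"
proof -
  have sub: "S \<subseteq> B \<union> A" using sccs_verts_subsets[OF assms] verts_eq by simp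
  obtain v where v: "v \<in> S" using assms by (auto simp: in_sccs_verts_conv_reachable)
  obtain w where w: "v \<rightarrow>\<^bsub>G\<^esub> w" using no_isolated[of v] v sub verts_eq by auto
  have "w \<in> S" using adj_sccs_verts[OF assms w] v by simp
  then have "S \<inter> B \<noteq> {}" "S \<inter> A \<noteq> {}" using v bipartite[OF w] by auto
  moreover have "S \<inter> B \<union> S \<inter> A = S" using sub by auto
  ultimately show ?thesis using assms by (simp add: components_iff sub_brick_def)
qed

lemma components_cover:
  shows "(\<Union>W\<in>components G (B, A). row W) = B" and "(\<Union>W\<in>components G (B, A). col W) = A"
proof -
  have "\<exists>W\<in>components G (B, A). v \<in> row W \<union> col W" if "v \<in> B \<union> A" for v
  proof
    have v: "v \<in> verts G" using that verts_eq by simp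
    show "(scc_of v \<inter> B, scc_of v \<inter> A) \<in> components G (B, A)"
      by (rule sccs_verts_component[OF scc_of_in_sccs_verts[OF v]])
    show "v \<in> row (scc_of v \<inter> B, scc_of v \<inter> A) \<union> col (scc_of v \<inter> B, scc_of v \<inter> A)"
      using in_scc_of_self[OF v] that by auto
  qed
  then have "B \<union> A \<subseteq> (\<Union>W\<in>components G (B, A). row W) \<union> (\<Union>W\<in>components G (B, A). col W)"
    by blast
  moreover have "(\<Union>W\<in>components G (B, A). row W) \<subseteq> B" "(\<Union>W\<in>components G (B, A). col W) \<subseteq> A"
    using component_sub_brick by blast+
  \<comment> \<open>The vertices are covered jointly; as each union stays on its own side and the
    sides are disjoint, each side is covered separately.\<close>
  ultimately show "(\<Union>W\<in>components G (B, A). row W) = B" "(\<Union>W\<in>components G (B, A). col W) = A"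
    using sides_disjoint by blast+
qed

text \<open>Because \<open>B\<close> and \<open>A\<close> are disjoint, a brick can be recovered
  from its vertex set. Distinct components therefore have distinct vertex sets, and distinct
  strongly connected components do not meet.\<close>

lemma components_disjoint:
  assumes "W \<in> components G (B, A)" "W' \<in> components G (B, A)" "W \<noteq> W'"
  shows "row W \<inter> row W' = {}" "col W \<inter> col W' = {}"
proof -
  have "row W \<union> col W \<noteq> row W' \<union> col W'"
  proof
    assume eq: "row W \<union> col W = row W' \<union> col W'"
    have "row W = row W'" "col W = col W'"
      using eq component_sub_brick[OF assms(1)] component_sub_brick[OF assms(2)] sides_disjoint
      by blast+
    then show False using assms(3) by (simp add: prod_eq_iff)
  qed
  then have "(row W \<union> col W) \<inter> (row W' \<union> col W') = {}"
    using assms sccs_verts_disjoint by (auto simp: components_iff)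
  then show "row W \<inter> row W' = {}" "col W \<inter> col W' = {}" by auto
qed

lemma finite_components: "finite (components G (B, A))"
proof (rule finite_subset)
  show "components G (B, A) \<subseteq> Pow B \<times> Pow A"
    by (auto simp: components_iff sub_brick_def)
qed (use finite_rows finite_cols in auto)

lemma finite_component:
  assumes "W \<in> components G (B, A)"
  shows "finite (row W)" "finite (col W)"
  using component_sub_brick[OF assms] finite_rows finite_cols by (auto intro: finite_subset)

section \<open>Counting across components\<close>

lemma sum_card_rows:
  assumes "Y \<subseteq> B"
  shows "(\<Sum>W\<in>components G (B, A). card (Y \<inter> row W)) = card Y"
proof -
  have "Y = (\<Union>W\<in>components G (B, A). Y \<inter> row W)" using components_cover(1) assms by blast
  then have "card Y = card (\<Union>W\<in>components G (B, A). Y \<inter> row W)" by simp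
  also have "\<dots> = (\<Sum>W\<in>components G (B, A). card (Y \<inter> row W))"
    using finite_components finite_component components_disjoint
    by (intro card_UN_disjoint) (auto simp: disjoint_iff)
  finally show ?thesis by simp
qed

lemma sum_card_cols:
  assumes "X \<subseteq> A"
  shows "(\<Sum>W\<in>components G (B, A). card (X \<inter> col W)) = card X"
proof -
  have "X = (\<Union>W\<in>components G (B, A). X \<inter> col W)" using components_cover(2) assms by blast
  then have "card X = card (\<Union>W\<in>components G (B, A). X \<inter> col W)" by simp
  also have "\<dots> = (\<Sum>W\<in>components G (B, A). card (X \<inter> col W))"
    using finite_components finite_component components_disjoint
    by (intro card_UN_disjoint) (auto simp: disjoint_iff)
  finally show ?thesis by simp
qed

lemma sum_imb_components: "(\<Sum>W\<in>components G (B, A). imb W) = imb (B, A)"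
proof -
  \<comment> \<open>Intersecting with \<open>B\<close> or \<open>A\<close> changes nothing, but
    brings the sums into the form of the counting lemmas.\<close>
  have "(\<Sum>W\<in>components G (B, A). card (row W)) = (\<Sum>W\<in>components G (B, A). card (B \<inter> row W))"
    "(\<Sum>W\<in>components G (B, A). card (col W)) = (\<Sum>W\<in>components G (B, A). card (A \<inter> col W))"
    using component_sub_brick by (auto intro!: sum.cong simp: Int_absorb1)
  then show ?thesis
    using sum_card_rows[of B] sum_card_cols[of A]
    by (simp add: imb_def sum_subtractf flip: of_nat_sum)
qed

section \<open>Disconnected grids\<close>

text \<open>A single component would have to cover the whole grid, which would then be
  connected.\<close>

lemma two_le_card_components:
  assumes "B \<noteq> {}" "\<not> connected (brick_graph G (B, A))"
  shows "2 \<le> card (components G (B, A))"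
proof (rule ccontr)
  assume "\<not> ?thesis"
  moreover have "components G (B, A) \<noteq> {}" using components_cover(1) assms(1) by auto
  then have "card (components G (B, A)) \<noteq> 0" using finite_components by simp
  ultimately have "card (components G (B, A)) = 1" by simp
  then obtain W where W: "components G (B, A) = {W}" by (rule card_1_singletonE)
  then have "row W = B" "col W = A" using components_cover by auto
  then have "B \<union> A \<in> sccs_verts" using W components_iff[of W] by simp
  then show False
    using assms(2) by (simp add: sccs_verts_iff_maximal_connected brick_graph_def)
qed

text \<open>A second component owns a row and a column outside \<open>W\<close>. This provides the
  proper inclusions that the definition of \<open>hole\<close> demands.\<close>

lemma component_proper:
  assumes W: "W \<in> components G (B, A)" and nc: "\<not> connected (brick_graph G (B, A))"
  shows "row W \<noteq> B" "col W \<noteq> A"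
proof -
  have "B \<noteq> {}" using component_sub_brick[OF W] by auto
  then have "2 \<le> card (components G (B, A))" using two_le_card_components nc by simp
  then have "components G (B, A) \<noteq> {W}" by auto
  then obtain W' where W': "W' \<in> components G (B, A)" "W' \<noteq> W"
    using W by auto
  show "row W \<noteq> B" "col W \<noteq> A"
    using components_disjoint[OF W'(1) W W'(2)] component_sub_brick[OF W'(1)] by auto
qed

section \<open>Holes of the grid built from one component\<close>

text \<open>No dot joins a column of \<open>W\<close> to a row outside \<open>W\<close>, and
  disconnectedness guarantees such rows and further columns.\<close>

lemma imbalance_hole:
  assumes W: "W \<in> components G (B, A)" and nc: "\<not> connected (brick_graph G (B, A))"
  shows "hole G (B, A) (B - row W, col W)"
    and "int (vcount (B - row W, col W)) = int (card B) - imb W"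
proof -
  note sub = component_sub_brick[OF W] and proper = component_proper[OF W nc]
  show "hole G (B, A) (B - row W, col W)"
    using sub proper adj_component[OF W] by (auto simp: hole_def sub_brick_def dot_free_def)
  show "int (vcount (B - row W, col W)) = int (card B) - imb W"
    using sub finite_component[OF W] card_mono[OF finite_rows sub(3)]
    by (simp add: vcount_def imb_def card_Diff_subset of_nat_diff)
qed

text \<open>The rows outside \<open>W\<close> have no dot in the columns of \<open>W\<close>, so
  they can all join the hole. A row of \<open>W\<close> missing from \<open>H\<close> is still
  missing afterwards. The count is stated additively to avoid subtraction on naturals.\<close>

lemma extended_hole:
  assumes W: "W \<in> components G (B, A)" and nc: "\<not> connected (brick_graph G (B, A))"
    and H: "hole G W H"
  shows "hole G (B, A) (row H \<union> (B - row W), col H)"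
    and "vcount (row H \<union> (B - row W), col H) + card (row W) = card B + vcount H"
proof -
  note sub = component_sub_brick[OF W] and proper = component_proper[OF W nc]
  have Hs: "row H \<noteq> {}" "col H \<noteq> {}" "row H \<subseteq> row W" "col H \<subseteq> col W" "row H \<noteq> row W"
    and df: "dot_free G H"
    using H by (auto simp: hole_def sub_brick_def)
  have "dot_free G (row H \<union> (B - row W), col H)"
    using df Hs adj_component[OF W] by (auto simp: dot_free_def)
  then show "hole G (B, A) (row H \<union> (B - row W), col H)"
    using sub proper Hs by (auto simp: hole_def sub_brick_def)
  have "card (row H \<union> (B - row W)) = card (row H) + card (B - row W)"
    using Hs finite_component[OF W] finite_rows by (intro card_Un_disjoint) (auto intro: finite_subset)
  moreover have "card (B - row W) + card (row W) = card B"
    using sub finite_component[OF W] card_mono[OF finite_rows sub(3)]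
    by (simp add: card_Diff_subset)
  ultimately show "vcount (row H \<union> (B - row W), col H) + card (row W) = card B + vcount H"
    by (simp add: vcount_def)
qed

section \<open>Excess of the components and holes in their strips\<close>

lemma hole_less_if_excessive:
  assumes "excessive G (B, A)" "hole G (B, A) H"
  shows "vcount H < card B"
  using assms hole_le_alpha_p[of "(B, A)" G H] finite_rows finite_cols
  by (auto simp: excessive_def m_excessive_def characteristic_def)

text \<open>The hole made of \<open>col W\<close> and the rows outside \<open>W\<close> has vcount
  \<open>card B - imb W\<close>, which excessiveness of the grid forces below
  \<open>card B\<close>.\<close>

lemma component_vertical:
  assumes "W \<in> components G (B, A)" "\<not> connected (brick_graph G (B, A))" "excessive G (B, A)"
  shows "0 < imb W" "vertical W"
proof -
  show "0 < imb W"
    using imbalance_hole[OF assms(1,2)] hole_less_if_excessive[OF assms(3)] by force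
  then show "vertical W" by (simp add: vertical_def imb_def)
qed

lemma component_characteristic_pos:
  assumes W: "W \<in> components G (B, A)" and nc: "\<not> connected (brick_graph G (B, A))"
    and exc: "excessive G (B, A)"
  shows "0 < characteristic G W"
proof (cases "alpha_p G W = 0")
  case True
  \<comment> \<open>Here the characteristic is just the number of rows of \<open>W\<close>, which is
    positive.\<close>
  then show ?thesis
    using component_sub_brick(1)[OF W] finite_component(1)[OF W]
    by (simp add: characteristic_def card_gt_0_iff)
next
  case False
  then obtain H where H: "hole G W H" "vcount H = alpha_p G W"
    using alpha_p_attained finite_component[OF W] by metis
  then show ?thesis
    using extended_hole[OF W nc H(1)] hole_less_if_excessive[OF exc]
    by (force simp: characteristic_def)
qed

text \<open>The smaller of the two quantities selects the hole: all rows outside \<open>W\<close>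
  over all of \<open>col W\<close> for the imbalance, an extended largest hole of \<open>W\<close>
  for the characteristic.\<close>

lemma strip_hole:
  assumes W: "W \<in> components G (B, A)" and nc: "\<not> connected (brick_graph G (B, A))"
  obtains H where "hole G (B, A) H" "sub_brick H (B, col W)"
    "int (vcount H) = int (card B) - min (characteristic G W) (imb W)"
proof (cases "imb W \<le> characteristic G W")
  case True
  then show ?thesis
    using that[OF imbalance_hole(1)[OF W nc]] imbalance_hole[OF W nc]
    by (auto simp: hole_def sub_brick_def)
next
  case False
  \<comment> \<open>A characteristic below the imbalance means that \<open>alpha_p G W\<close>
    exceeds the number of columns of \<open>W\<close>, so a largest hole exists.\<close>
  then have "alpha_p G W \<noteq> 0" by (auto simp: characteristic_def imb_def)
  then obtain H where H: "hole G W H" "vcount H = alpha_p G W"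
    using alpha_p_attained finite_component[OF W] by metis
  show ?thesis
  proof (rule that)
    show "hole G (B, A) (row H \<union> (B - row W), col H)" by (rule extended_hole(1)[OF W nc H(1)])
    then show "sub_brick (row H \<union> (B - row W), col H) (B, col W)"
      using H(1) by (auto simp: hole_def sub_brick_def)
    show "int (vcount (row H \<union> (B - row W), col H)) =
        int (card B) - min (characteristic G W) (imb W)"
      using extended_hole(2)[OF W nc H(1)] H(2) False by (simp add: characteristic_def)
  qed
qed

section \<open>Upper bound on holes and the excess of the grid\<close>

text \<open>If \<open>H\<close> has no row in \<open>W\<close>, at most the columns of
  \<open>W\<close> count, and there are \<open>imb W\<close> fewer of these than rows. Otherwise the
  intersection is a hole of \<open>W\<close> and the characteristic gives the bound.\<close>

lemma hole_inter_component:
  assumes W: "W \<in> components G (B, A)" and H: "hole G (B, A) H" and ne: "col H \<inter> col W \<noteq> {}"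
  shows "int (card (row H \<inter> row W)) + int (card (col H \<inter> col W)) \<le>
    int (card (row W)) - min (characteristic G W) (imb W)"
proof (cases "row H \<inter> row W = {}")
  case True
  have "card (col H \<inter> col W) \<le> card (col W)"
    using finite_component[OF W] by (intro card_mono) auto
  then show ?thesis using True by (simp add: imb_def)
next
  case False
  note sub = component_sub_brick[OF W]
  have df: "\<not> y \<rightarrow>\<^bsub>G\<^esub> x" if "y \<in> row H" "x \<in> col H" for x y
    using H that by (auto simp: hole_def dot_free_def)
  \<comment> \<open>A column of \<open>H\<close> in \<open>W\<close> has a neighbouring row,
    necessarily in \<open>W\<close>; if \<open>H\<close> had all rows of \<open>W\<close>, it would
    contain that dot. The argument for the columns is symmetric.\<close>
  have "row H \<inter> row W \<noteq> row W"
  proof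
    assume eq: "row H \<inter> row W = row W"
    obtain x where x: "x \<in> col H" "x \<in> col W" using ne by auto
    obtain y where y: "x \<rightarrow>\<^bsub>G\<^esub> y" using no_isolated[of x] x sub verts_eq by auto
    have "y \<in> B" using bipartite[OF y] x sub sides_disjoint by auto
    moreover have "y \<rightarrow>\<^bsub>G\<^esub> x" using y graph_symmetric by blast
    ultimately have "y \<in> row W" using adj_component[OF W] x by blast
    then show False using df eq x \<open>y \<rightarrow>\<^bsub>G\<^esub> x\<close> by blast
  qed
  moreover have "col H \<inter> col W \<noteq> col W"
  proof
    assume eq: "col H \<inter> col W = col W"
    obtain y where y: "y \<in> row H" "y \<in> row W" using False by auto
    obtain x where x: "y \<rightarrow>\<^bsub>G\<^esub> x" using no_isolated[of y] y sub verts_eq by auto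
    have "x \<in> col W" using adj_component[OF W x] y sub by blast
    then show False using df eq x y by blast
  qed
  ultimately have "hole G W (row H \<inter> row W, col H \<inter> col W)"
    using False ne df by (auto simp: hole_def sub_brick_def dot_free_def)
  from hole_le_alpha_p[OF finite_component[OF W] this] show ?thesis
    by (simp add: vcount_def characteristic_def)
qed

text \<open>The hole is split along the components. One component containing a column of
  \<open>H\<close> yields the full saving; for the others the bound by their number of rows
  suffices.\<close>

lemma hole_le_some_component:
  assumes H: "hole G (B, A) H" and nc: "\<not> connected (brick_graph G (B, A))"
    and exc: "excessive G (B, A)"
  shows "\<exists>W\<in>components G (B, A).
    int (vcount H) \<le> int (card B) - min (characteristic G W) (imb W)"
proof -
  let ?C = "components G (B, A)"
  let ?f = "\<lambda>W. int (card (row H \<inter> row W)) + int (card (col H \<inter> col W))"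
  have sub: "row H \<subseteq> B" "col H \<subseteq> A" "col H \<noteq> {}"
    using H by (auto simp: hole_def sub_brick_def)
  then obtain W where W: "W \<in> ?C" and ne: "col H \<inter> col W \<noteq> {}"
    using components_cover(2) by blast
  \<comment> \<open>Without columns in \<open>V\<close> only rows are counted; with columns, the
    saving is positive since both characteristic and imbalance are.\<close>
  have le: "?f V \<le> int (card (row V))" if V: "V \<in> ?C" for V
  proof (cases "col H \<inter> col V = {}")
    case True
    then show ?thesis using finite_component[OF V] by (simp add: card_mono)
  next
    case False
    then show ?thesis
      using hole_inter_component[OF V H] component_vertical(1)[OF V nc exc]
        component_characteristic_pos[OF V nc exc] by linarith
  qed
  have "int (vcount H) = (\<Sum>V\<in>?C. ?f V)"
    using sum_card_rows[OF sub(1)] sum_card_cols[OF sub(2)]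
    by (simp add: vcount_def sum.distrib flip: of_nat_sum)
  also have "\<dots> = ?f W + (\<Sum>V\<in>?C - {W}. ?f V)"
    using W finite_components by (simp add: sum.remove)
  also have "\<dots> \<le> (int (card (row W)) - min (characteristic G W) (imb W)) +
      (\<Sum>V\<in>?C - {W}. int (card (row V)))"
    using hole_inter_component[OF W H ne] le by (intro add_mono sum_mono) auto
  also have "\<dots> = (\<Sum>V\<in>?C. int (card (row V))) - min (characteristic G W) (imb W)"
    using W finite_components by (simp add: sum.remove)
  also have "(\<Sum>V\<in>?C. int (card (row V))) = (\<Sum>V\<in>?C. int (card (B \<inter> row V)))"
    using component_sub_brick by (intro sum.cong) (auto simp: Int_absorb1)
  also have "\<dots> = int (card B)"
    using sum_card_rows[of B] by (simp flip: of_nat_sum)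
  finally show ?thesis using W by blast
qed

text \<open>The strip holes make the characteristic a lower bound of all the minima. A largest hole
  of the grid falls short of \<open>card B\<close> by at least one of them, so the bound is
  attained.\<close>

lemma characteristic_grid:
  assumes ne: "B \<noteq> {}" and nc: "\<not> connected (brick_graph G (B, A))"
    and exc: "excessive G (B, A)"
  shows "characteristic G (B, A) =
    Min ((\<lambda>W. min (characteristic G W) (imb W)) ` components G (B, A))"
proof (rule sym, rule Min_eqI)
  let ?s = "\<lambda>W. min (characteristic G W) (imb W)"
  show "finite (?s ` components G (B, A))" using finite_components by simp
  have char: "characteristic G (B, A) = int (card B) - int (alpha_p G (B, A))"
    by (simp add: characteristic_def)
  have ge: "characteristic G (B, A) \<le> ?s W" if W: "W \<in> components G (B, A)" for W
  proof -
    obtain H where "hole G (B, A) H" "int (vcount H) = int (card B) - ?s W"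
      using strip_hole[OF W nc] by blast
    moreover have "vcount H \<le> alpha_p G (B, A)"
      using calculation(1) finite_rows finite_cols by (simp add: hole_le_alpha_p)
    ultimately show ?thesis using char by linarith
  qed
  then show "\<And>t. t \<in> ?s ` components G (B, A) \<Longrightarrow> characteristic G (B, A) \<le> t" by blast
  obtain W0 where W0: "W0 \<in> components G (B, A)" using components_cover(1) ne by blast
  \<comment> \<open>Any component supplies a nonempty hole of the grid, which excludes the default
    value 0.\<close>
  have "alpha_p G (B, A) \<noteq> 0"
    using hole_le_alpha_p[OF _ _ imbalance_hole(1)[OF W0 nc]] component_sub_brick[OF W0]
      finite_component[OF W0] finite_rows finite_cols
    by (force simp: vcount_def card_gt_0_iff)
  then obtain H where H: "hole G (B, A) H" "vcount H = alpha_p G (B, A)"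
    using alpha_p_attained[of "(B, A)" G] finite_rows finite_cols by auto
  obtain W where W: "W \<in> components G (B, A)" "int (vcount H) \<le> int (card B) - ?s W"
    using hole_le_some_component[OF H(1) nc exc] by blast
  then have "?s W \<le> characteristic G (B, A)"
    using H(2) char by linarith
  then show "characteristic G (B, A) \<in> ?s ` components G (B, A)"
    using ge[OF W(1)] W(1) by (intro image_eqI[of _ _ W]) auto
qed

end

theorem proposition5p45:
  fixes G :: "('v, 'e) pre_digraph"
    and A B :: "'v set"
    and a b p :: nat
    and W :: "nat \<Rightarrow> 'v brick"
    and m s :: "nat \<Rightarrow> int"
  assumes grid: "bipartite_grid G B A"
    and b: "card B = b" and a: "card A = a"
    and vert: "vertical (B, A)"
    and exc: "excessive G (B, A)"
    and not_conn: "\<not> connected (brick_graph G (B, A))"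
    and comps: "bij_betw W {1..p} (components G (B, A))"
    and m: "\<And>i. i \<in> {1..p} \<Longrightarrow> m i = characteristic G (W i)"
    and s: "\<And>i. i \<in> {1..p} \<Longrightarrow> s i = min (m i) (imb (W i))"
  shows "2 \<le> p \<and> (\<forall>i\<in>{1..p}. vertical (W i) \<and> m_excessive G (m i) (W i)) \<and>
    (\<forall>i\<in>{1..p}. \<exists>H. hole G (B, A) H \<and> sub_brick H (B, col (W i))
                      \<and> int (vcount H) = int b - s i) \<and>
    m_excessive G (Min (s ` {1..p})) (B, A) \<and>
    (\<Sum>i = 1..p. imb (W i)) = imb (B, A) \<and> imb (B, A) = int b - int a"
proof -
  interpret bipartite_grid G B A by (rule grid)
  have ne: "B \<noteq> {}" using vert by (auto simp: vertical_def)
  have mem: "W i \<in> components G (B, A)" if "i \<in> {1..p}" for i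
    using comps that by (rule bij_betwE[rule_format])
  have image: "W ` {1..p} = components G (B, A)" using comps by (simp add: bij_betw_def)
  have "2 \<le> p"
    using two_le_card_components[OF ne not_conn] bij_betw_same_card[OF comps] by simp
  moreover have "vertical (W i) \<and> m_excessive G (m i) (W i)" if "i \<in> {1..p}" for i
    using component_vertical[OF mem[OF that] not_conn exc] m[OF that]
      component_characteristic_pos[OF mem[OF that] not_conn exc]
    by (simp add: m_excessive_def vertical_def)
  moreover have "\<exists>H. hole G (B, A) H \<and> sub_brick H (B, col (W i)) \<and> int (vcount H) = int b - s i"
    if "i \<in> {1..p}" for i
    using strip_hole[OF mem[OF that] not_conn] m[OF that] s[OF that] b by metis
  moreover have "m_excessive G (Min (s ` {1..p})) (B, A)"
  proof -
    have "s ` {1..p} = (\<lambda>V. min (characteristic G V) (imb V)) ` components G (B, A)"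
      unfolding image[symmetric] image_image using m s by (intro image_cong) auto
    then have "characteristic G (B, A) = Min (s ` {1..p})"
      using characteristic_grid[OF ne not_conn exc] by simp
    \<comment> \<open>Positivity of the minimum comes from \<open>exc\<close>, now that it is known
      to be the characteristic.\<close>
    then show ?thesis using exc by (auto simp: excessive_def m_excessive_def)
  qed
  moreover have "(\<Sum>i = 1..p. imb (W i)) = imb (B, A)"
    using sum.reindex_bij_betw[OF comps, of imb] sum_imb_components by simp
  moreover have "imb (B, A) = int b - int a" using a b by (simp add: imb_def)
  ultimately show ?thesis by blast
qed

end
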